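(* For every $\gamma>0$ there are constants $c_1=c_1(\gamma)>0$, $\mu=\mu(\gamma)>0$, $C=C(\gamma)>0$ and $n_0=n_0(\gamma)$ such that the following holds. Let $n\ge n_0$, $p\ge C/n$, $0\le r\le\mu\sqrt{np}$, and let $G$ be a $(p,r)$-pseudorandom directed graph on $n$ vertices. Let $G'$ be a subgraph of $G$ with at least $(\tfrac12+\gamma)|E(G)|$ edges. Then $G'$ contains a directed cycle of length at least $c_1 n$.
   Context: Directed graphs are finite, without loops or multiple parallel edges, but antiparallel edges (both $xy$ and $yx$) are allowed. A directed graph $G=(V,E)$ on $n$ vertices has edge density $p$ if $|E|=pn^2$. For disjoint $A,B\subseteq V$, $e_G(A,B)$ denotes the number of edges of $G$ directed from $A$ to $B$. $G$ is $(p,r)$-pseudorandom if it has edge density $p$ and for every two disjoint sets $A,B\subseteq V$ with $|A|=|B|$, $$\bigl|e_G(A,B)-p|A||B|\bigr|\le r|A|\sqrt{pn}.$$ Directed cycles are simple; the length of a cycle is its number of edges (equivalently vertices). *)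

theory Defs
  imports Complex_Main "Graph_Theory.Digraph_Component"
begin

definition num_arcs_between :: "('a, 'b) pre_digraph \<Rightarrow> 'a set \<Rightarrow> 'a set \<Rightarrow> nat" where
  "num_arcs_between G A B = card {e \<in> arcs G. tail G e \<in> A \<and> head G e \<in> B}"

text \<open>The normalisation is by \<open>n\<^sup>2\<close>, not by the number \<open>n * (n - 1)\<close> of possible arcs.\<close>

definition has_edge_density :: "('a, 'b) pre_digraph \<Rightarrow> real \<Rightarrow> bool" where
  "has_edge_density G p \<longleftrightarrow> real (card (arcs G)) = p * (real (card (verts G)))\<^sup>2"

definition pseudorandom :: "real \<Rightarrow> real \<Rightarrow> ('a, 'b) pre_digraph \<Rightarrow> bool" where
  "pseudorandom p r G \<longleftrightarrow>
     has_edge_density G p \<and>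
     (\<forall>A B. A \<subseteq> verts G \<and> B \<subseteq> verts G \<and> A \<inter> B = {} \<and> card A = card B \<longrightarrow>
        \<bar>real (num_arcs_between G A B) - p * real (card A) * real (card B)\<bar>
          \<le> r * real (card A) * sqrt (p * real (card (verts G))))"

end

theory Submission
  imports Defs "HOL-Library.Tree"
begin

text \<open>
  Suppose that every cycle of \<open>G'\<close> has length at most \<open>k\<close>, where \<open>k\<close> is a small fraction of \<open>n\<close>.
  Run a depth-first search on \<open>G'\<close> and list the vertices in reverse finishing order.
  An arc of \<open>G'\<close> that goes backwards in this list ends in an ancestor of its tail, and together with the
  tree path from that ancestor it closes a cycle; so the ancestor is one of the \<open>k\<close> nearest ones.

  The point is that such near-ancestor arcs form a structure with small separators. Walking up the forest
  from the leaves and cutting as soon as \<open>s\<close> vertices have accumulated, one only has to delete the \<open>k\<close>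
  nearest ancestors at each cut, because no surviving backward arc jumps over them. There are at most
  \<open>n / s\<close> cuts, hence at most \<open>k * n / s\<close> deleted vertices, and the remaining backward arcs stay inside parts
  with fewer than \<open>2 * s\<close> vertices (\<open>near_ancestors_separator\<close>).

  Take \<open>s\<close> close to \<open>n / D\<close> and \<open>k\<close> close to \<open>n / D\<^sup>2\<close> for a large constant \<open>D\<close>. All but \<open>O(n\<^sup>2 / D)\<close> of the about
  \<open>n\<^sup>2 / 2\<close> backward pairs avoid the deleted vertices, join different parts, and lie in different
  blocks of \<open>s\<close> consecutive places of the list. Such a pair is never an arc of \<open>G'\<close>. These pairs
  make up a bounded number of products \<open>A \<times> B\<close> of disjoint vertex sets, and \<open>G\<close> has almost \<open>p * |A| * |B|\<close> arcs
  on each product (\<open>pseudorandom_arcs_between_lower\<close>). So \<open>G'\<close> misses at least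
  \<open>(1/2 - 5/D) * p * n\<^sup>2\<close> arcs of \<open>G\<close> (\<open>many_arcs_missed_without_long_cycle\<close>). As \<open>G\<close> has \<open>p * n\<^sup>2\<close> arcs,
  this is impossible for a subgraph with a share \<open>1/2 + \<gamma>\<close> of them once \<open>D > 5 / \<gamma>\<close>.
\<close>

section \<open>Depth-first search forests\<close>

text \<open>
  A rooted forest is encoded as a binary tree: in \<open>Node l c r\<close> the right subtree \<open>r\<close> holds the children of
  \<open>c\<close> with their descendants, and the left subtree \<open>l\<close> holds the trees that are explored after the one of
  \<open>c\<close>. With this encoding the inorder traversal is the reverse finishing order of the search. The set \<open>N\<close>
  contains the admissible roots: at the top level all vertices, below \<open>c\<close> the out-neighbours of \<open>c\<close>.
\<close>

fun dfs_forest :: "('a \<times> 'a) set \<Rightarrow> 'a set \<Rightarrow> 'a tree \<Rightarrow> bool" where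
  "dfs_forest E N Leaf \<longleftrightarrow> True"
| "dfs_forest E N (Node l c r) \<longleftrightarrow>
     c \<in> N \<and> dfs_forest E (E `` {c}) r \<and> dfs_forest E N l \<and>
     (\<forall>x\<in>insert c (set_tree r). \<forall>y\<in>set_tree l. (x, y) \<notin> E)"

text \<open>
  The search from a root \<open>c\<close> explores exactly the set \<open>R\<close> of vertices reachable from \<open>c\<close>, so no arc leaves \<open>R\<close>.
  This is why the induction can treat \<open>R - {c}\<close>, below \<open>c\<close>, and \<open>U - R\<close>, beside \<open>c\<close>, separately: a path
  that ends outside \<open>R\<close> never meets \<open>R\<close>, and a path inside \<open>R\<close> starting from \<open>c\<close> can be cut at its last
  visit to \<open>c\<close>.
\<close>

lemma dfs_forest_exists:
  assumes "finite U" and "\<forall>x\<in>U. \<exists>y\<in>N \<inter> U. (y, x) \<in> (Restr E U)\<^sup>*"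
  shows "\<exists>t. dfs_forest E N t \<and> set_tree t = U \<and> distinct (inorder t)"
  using assms
proof (induction U arbitrary: N rule: finite_psubset_induct)
  case (psubset U)
  show ?case
  proof (cases "U = {}")
    case True
    then show ?thesis by (intro exI[of _ Leaf]) simp
  next
    case False
    then obtain c where c: "c \<in> N" "c \<in> U" using psubset.prems by blast
    define R where "R = (Restr E U)\<^sup>* `` {c}"
    have cR: "c \<in> R" unfolding R_def by blast
    have RU: "R \<subseteq> U"
    proof
      fix x assume "x \<in> R"
      then have "(c, x) \<in> (Restr E U)\<^sup>*" unfolding R_def by blast
      then show "x \<in> U" by (cases rule: rtranclE) (use c in auto)
    qed
    have R_closed: "y \<in> R" if "x \<in> R" "(x, y) \<in> E" "y \<in> U" for x y
    proof -
      have "(x, y) \<in> Restr E U" using that RU by blast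
      then show ?thesis using that(1) unfolding R_def
        by (auto intro: rtrancl_into_rtrancl)
    qed
    have "\<exists>y\<in>E `` {c} \<inter> (R - {c}). (y, x) \<in> (Restr E (R - {c}))\<^sup>*" if x: "x \<in> R - {c}" for x
    proof -
      have "(c, x) \<in> (Restr E U)\<^sup>*" using x unfolding R_def by blast
      then have "x = c \<or> (\<exists>y\<in>E `` {c} \<inter> (R - {c}). (y, x) \<in> (Restr E (R - {c}))\<^sup>*)"
      proof (induction rule: rtrancl_induct)
        case base
        then show ?case by simp
      next
        case (step z w)
        have zR: "z \<in> R" using step.hyps(1) unfolding R_def by blast
        then have wR: "w \<in> R" using step.hyps(2) R_closed by blast
        show ?case
        proof (cases "w = c \<or> z = c")
          case True
          then show ?thesis using step.hyps(2) wR by blast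
        next
          case False
          then obtain y where y: "y \<in> E `` {c} \<inter> (R - {c})" "(y, z) \<in> (Restr E (R - {c}))\<^sup>*"
            using step.IH by blast
          have "(z, w) \<in> Restr E (R - {c})" using False zR wR step.hyps(2) by blast
          then show ?thesis using y by (meson rtrancl_into_rtrancl)
        qed
      qed
      then show ?thesis using x by blast
    qed
    moreover have "R - {c} \<subset> U" using c RU by blast
    ultimately obtain r where r: "dfs_forest E (E `` {c}) r" "set_tree r = R - {c}" "distinct (inorder r)"
      using psubset.IH[of "R - {c}" "E `` {c}"] by blast
    have "\<exists>y\<in>N \<inter> (U - R). (y, x) \<in> (Restr E (U - R))\<^sup>*" if x: "x \<in> U - R" for x
    proof -
      obtain y where y: "y \<in> N \<inter> U" "(y, x) \<in> (Restr E U)\<^sup>*" using psubset.prems x by blast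
      from y(2) have "y \<notin> R \<and> (y, x) \<in> (Restr E (U - R))\<^sup>*"
      proof (induction rule: converse_rtrancl_induct)
        case base
        then show ?case using x by simp
      next
        case (step y z)
        have "y \<notin> R" using step R_closed by blast
        then have "(y, z) \<in> Restr E (U - R)" using step by blast
        then show ?case using step.IH \<open>y \<notin> R\<close> by (meson converse_rtrancl_into_rtrancl)
      qed
      then show ?thesis using y by blast
    qed
    moreover have "U - R \<subset> U" using c cR by blast
    ultimately obtain l where l: "dfs_forest E N l" "set_tree l = U - R" "distinct (inorder l)"
      using psubset.IH[of "U - R" N] by blast
    show ?thesis
      using c cR RU r l R_closed by (intro exI[of _ "Node l c r"]) auto
  qed
qed

text \<open>
  Pairs of a vertex and one of its \<open>k\<close> nearest proper ancestors. The stack \<open>P\<close> lists the ancestors of the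
  whole forest, nearest first.
\<close>

fun near_ancestors :: "nat \<Rightarrow> 'a list \<Rightarrow> 'a tree \<Rightarrow> ('a \<times> 'a) set" where
  "near_ancestors k P Leaf = {}"
| "near_ancestors k P (Node l c r) =
     {c} \<times> set (take k P) \<union> near_ancestors k (c # P) r \<union> near_ancestors k P l"

text \<open>
  The vertices of a cycle are listed against the direction of its arcs, so that an initial segment of a
  search stack is directly such a list.
\<close>

definition reversed_cycle :: "('a \<times> 'a) set \<Rightarrow> 'a list \<Rightarrow> bool" where
  "reversed_cycle E xs \<longleftrightarrow> xs \<noteq> [] \<and> distinct xs \<and> successively (\<lambda>a b. (b, a) \<in> E) xs \<and> (hd xs, last xs) \<in> E"

text \<open>
  The stack is a path that descends to the current vertex, and an arc from this vertex back to the entry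
  with index \<open>i\<close> closes a cycle through \<open>i + 2\<close> vertices; hence \<open>i < k\<close>.
\<close>

lemma dfs_arc_to_stack_is_near:
  assumes short: "\<forall>xs. reversed_cycle E xs \<longrightarrow> length xs \<le> k"
    and "dfs_forest E N t" and "distinct (inorder t)" and "distinct P" and "set P \<inter> set_tree t = {}"
    and "successively (\<lambda>a b. (b, a) \<in> E) P" and "P \<noteq> [] \<Longrightarrow> N \<subseteq> E `` {hd P}"
    and "x \<in> set_tree t" and "a \<in> set P" and "(x, a) \<in> E"
  shows "(x, a) \<in> near_ancestors k P t"
  using assms(2-)
proof (induction t arbitrary: N P)
  case Leaf
  then show ?case by simp
next
  case (Node l c r)
  have ne: "P \<noteq> []" using Node.prems by auto
  have path: "successively (\<lambda>a b. (b, a) \<in> E) (c # P)"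
    using Node.prems ne by (cases P) auto
  from Node.prems consider "x = c" | "x \<in> set_tree r" | "x \<in> set_tree l" by auto
  then show ?case
  proof cases
    case 1
    obtain i where i: "i < length P" "P ! i = a" using Node.prems by (auto simp: in_set_conv_nth)
    have split: "c # P = (c # take (Suc i) P) @ drop (Suc i) P" by simp
    have "last (c # take (Suc i) P) = a" using i by (simp add: take_Suc_conv_app_nth)
    moreover have "successively (\<lambda>a b. (b, a) \<in> E) (c # take (Suc i) P)"
      using path split by (metis successively_append_iff)
    ultimately have "reversed_cycle E (c # take (Suc i) P)"
      unfolding reversed_cycle_def using Node.prems 1 by (auto dest: in_set_takeD)
    then have "i < k" using short i by fastforce
    then have "a \<in> set (take k P)" using i by (auto simp: in_set_conv_nth)
    then show ?thesis using 1 by simp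
  next
    case 2
    have "(x, a) \<in> near_ancestors k (c # P) r"
      using Node.prems path 2 by (intro Node.IH(2)) auto
    then show ?thesis by simp
  next
    case 3
    have "(x, a) \<in> near_ancestors k P l"
      using Node.prems 3 by (intro Node.IH(1)) auto
    then show ?thesis by simp
  qed
qed

lemma dfs_backward_arc_is_near:
  assumes short: "\<forall>xs. reversed_cycle E xs \<longrightarrow> length xs \<le> k"
    and "dfs_forest E N t" and "distinct (inorder t)" and "distinct P" and "set P \<inter> set_tree t = {}"
    and "successively (\<lambda>a b. (b, a) \<in> E) P" and "P \<noteq> [] \<Longrightarrow> N \<subseteq> E `` {hd P}"
  shows "sorted_wrt (\<lambda>y x. (x, y) \<in> E \<longrightarrow> (x, y) \<in> near_ancestors k P t) (inorder t)"
  using assms(2-)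
proof (induction t arbitrary: N P)
  case Leaf
  then show ?case by simp
next
  case (Node l c r)
  have path: "successively (\<lambda>a b. (b, a) \<in> E) (c # P)"
    using Node.prems by (cases P) auto
  have "sorted_wrt (\<lambda>y x. (x, y) \<in> E \<longrightarrow> (x, y) \<in> near_ancestors k P l) (inorder l)"
    using Node.prems by (intro Node.IH(1)) auto
  moreover have "sorted_wrt (\<lambda>y x. (x, y) \<in> E \<longrightarrow> (x, y) \<in> near_ancestors k (c # P) r) (inorder r)"
    using Node.prems path by (intro Node.IH(2)) auto
  moreover have "(x, c) \<in> near_ancestors k (c # P) r" if "x \<in> set_tree r" "(x, c) \<in> E" for x
    using Node.prems path that
    by (intro dfs_arc_to_stack_is_near[OF short, where N = "E `` {c}"]) auto
  ultimately show ?case using Node.prems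
    by (auto simp: sorted_wrt_append elim!: sorted_wrt_mono_rel[rotated])
qed

section \<open>Separating near-ancestor pairs\<close>

text \<open>
  The induction carries a residual set \<open>Q\<close> of fewer than \<open>s\<close> vertices, the only ones that may still form
  a pair with a stack vertex outside \<open>H\<close>. At a node the residual sets of the two subforests are merged with the node itself.
  When the union reaches \<open>s\<close>, it becomes a new part, and the top \<open>k\<close> stack entries are added to \<open>H\<close>, which
  hits every pair leading from the new part to the stack. Each part pays with at least \<open>s\<close> vertices for the \<open>k\<close>
  vertices added to \<open>H\<close>. The set \<open>H\<close> may overlap the parts: they partition all vertices of the forest.
\<close>

lemma near_ancestors_separator:
  assumes "distinct (inorder t)" and "s > 0"
  shows "\<exists>H \<C> Q. finite H \<and> finite \<C> \<and> card H \<le> k * card \<C> \<and>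
    disjoint \<C> \<and> Q \<inter> \<Union>\<C> = {} \<and> Q \<union> \<Union>\<C> = set_tree t \<and>
    card Q < s \<and> (\<forall>C\<in>\<C>. s \<le> card C \<and> card C < 2 * s) \<and>
    (\<forall>x a. (x, a) \<in> near_ancestors k P t \<longrightarrow>
        a \<in> H \<or> (\<exists>C\<in>\<C>. x \<in> C \<and> a \<in> C) \<or>
        (x \<in> Q \<and> (a \<in> Q \<or> a \<in> set (take k P))))"
  using assms(1)
proof (induction t arbitrary: P)
  case Leaf
  show ?case by (rule exI[of _ "{}"], rule exI[of _ "{}"], rule exI[of _ "{}"]) (use assms in simp)
next
  case (Node l c r)
  obtain Hr \<C>r Qr where r: "finite Hr" "finite \<C>r" "card Hr \<le> k * card \<C>r"
    "disjoint \<C>r" "Qr \<inter> \<Union>\<C>r = {}" "Qr \<union> \<Union>\<C>r = set_tree r"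
    "card Qr < s" "\<forall>C\<in>\<C>r. s \<le> card C \<and> card C < 2 * s"
    "\<forall>x a. (x, a) \<in> near_ancestors k (c # P) r \<longrightarrow> a \<in> Hr \<or> (\<exists>C\<in>\<C>r. x \<in> C \<and> a \<in> C) \<or>
        (x \<in> Qr \<and> (a \<in> Qr \<or> a \<in> set (take k (c # P))))"
    using Node.IH(2)[of "c # P"] Node.prems by auto
  obtain Hl \<C>l Ql where l: "finite Hl" "finite \<C>l" "card Hl \<le> k * card \<C>l"
    "disjoint \<C>l" "Ql \<inter> \<Union>\<C>l = {}" "Ql \<union> \<Union>\<C>l = set_tree l"
    "card Ql < s" "\<forall>C\<in>\<C>l. s \<le> card C \<and> card C < 2 * s"
    "\<forall>x a. (x, a) \<in> near_ancestors k P l \<longrightarrow> a \<in> Hl \<or> (\<exists>C\<in>\<C>l. x \<in> C \<and> a \<in> C) \<or>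
        (x \<in> Ql \<and> (a \<in> Ql \<or> a \<in> set (take k P)))"
    using Node.IH(1)[of P] Node.prems by auto
  define Q where "Q = insert c (Ql \<union> Qr)"
  define \<C> where "\<C> = \<C>l \<union> \<C>r"
  define H where "H = Hl \<union> Hr"
  have disj: "c \<notin> set_tree l" "c \<notin> set_tree r" "set_tree l \<inter> set_tree r = {}"
    using Node.prems by auto
  have fin: "finite Ql" "finite Qr"
    using l(6) r(6) finite_set_tree by (metis finite_Un)+
  have "card Q \<le> Suc (card (Ql \<union> Qr))" unfolding Q_def using fin by (simp add: card_insert_if)
  also have "\<dots> \<le> Suc (card Ql + card Qr)" using card_Un_le by simp
  finally have Q2s: "card Q < 2 * s" using l(7) r(7) by linarith
  have "\<C>l \<inter> \<C>r = {}"
  proof (rule ccontr)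
    assume "\<C>l \<inter> \<C>r \<noteq> {}"
    then obtain C where C: "C \<in> \<C>l" "C \<in> \<C>r" by blast
    then have "C = {}" using l(6) r(6) disj by blast
    then show False using C l(8) assms(2) by fastforce
  qed
  then have card\<C>: "card \<C> = card \<C>l + card \<C>r"
    unfolding \<C>_def using l r by (simp add: card_Un_disjoint)
  have cardH: "card H \<le> k * card \<C>"
    unfolding H_def card\<C> using card_Un_le[of Hl Hr] l(3) r(3) by (simp add: algebra_simps)
  have finH: "finite H" "finite \<C>" unfolding H_def \<C>_def using l r by auto
  have "\<Union>\<C>l \<inter> \<Union>\<C>r = {}" using l(6) r(6) disj by blast
  then have disj\<C>: "disjoint \<C>"
    unfolding \<C>_def using l(4) r(4) by (rule disjoint_union[rotated 2])
  have Q\<C>: "Q \<inter> \<Union>\<C> = {}"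
    unfolding Q_def \<C>_def using l(5,6) r(5,6) disj by blast
  have U: "Q \<union> \<Union>\<C> = set_tree (Node l c r)"
    unfolding Q_def \<C>_def tree.set using l(6) r(6) by blast
  have sizes: "\<forall>C\<in>\<C>. s \<le> card C \<and> card C < 2 * s" unfolding \<C>_def using l(8) r(8) by blast
  \<comment> \<open>A pair that leaves the children of \<open>c\<close> ends in \<open>c\<close>, which joins \<open>Q\<close>, or in the stack of \<open>c\<close>.\<close>
  have take: "set (take k (c # P)) \<subseteq> insert c (set (take k P))"
    by (cases k) (auto intro: set_take_subset_set_take[THEN subsetD, rotated])
  have near: "\<forall>x a. (x, a) \<in> near_ancestors k P (Node l c r) \<longrightarrow>
      a \<in> H \<or> (\<exists>C\<in>\<C>. x \<in> C \<and> a \<in> C) \<or> (x \<in> Q \<and> (a \<in> Q \<or> a \<in> set (take k P)))"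
  proof (intro allI impI)
    fix x a assume "(x, a) \<in> near_ancestors k P (Node l c r)"
    then consider "x = c" "a \<in> set (take k P)" | "(x, a) \<in> near_ancestors k (c # P) r"
      | "(x, a) \<in> near_ancestors k P l" by auto
    then show "a \<in> H \<or> (\<exists>C\<in>\<C>. x \<in> C \<and> a \<in> C) \<or> (x \<in> Q \<and> (a \<in> Q \<or> a \<in> set (take k P)))"
    proof cases
      case 1
      then show ?thesis unfolding Q_def by blast
    next
      case 2
      then have "a \<in> Hr \<or> (\<exists>C\<in>\<C>r. x \<in> C \<and> a \<in> C) \<or> (x \<in> Qr \<and> (a \<in> Qr \<or> a \<in> set (take k (c # P))))"
        using r(9) by blast
      then show ?thesis unfolding Q_def H_def \<C>_def using take by blast
    next
      case 3
      then have "a \<in> Hl \<or> (\<exists>C\<in>\<C>l. x \<in> C \<and> a \<in> C) \<or> (x \<in> Ql \<and> (a \<in> Ql \<or> a \<in> set (take k P)))"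
        using l(9) by blast
      then show ?thesis unfolding Q_def H_def \<C>_def by blast
    qed
  qed
  show ?case
  proof (cases "card Q < s")
    case True
    then show ?thesis
      using finH cardH disj\<C> Q\<C> U sizes near
      by (intro exI[of _ H] exI[of _ \<C>] exI[of _ Q] conjI) assumption+
  next
    case False
    have "Q \<noteq> {}" unfolding Q_def by simp
    then have new: "Q \<notin> \<C>" using Q\<C> by blast
    have "card (H \<union> set (take k P)) \<le> card H + k"
      using card_Un_le[of H "set (take k P)"] card_length[of "take k P"] by simp
    also have "\<dots> \<le> k * card (insert Q \<C>)" using cardH finH new by simp
    finally have 1: "card (H \<union> set (take k P)) \<le> k * card (insert Q \<C>)" .
    have 2: "disjoint (insert Q \<C>)" using disj\<C> Q\<C> by (auto simp: disjoint_def)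
    show ?thesis
    proof (intro exI conjI)
      show "finite (H \<union> set (take k P))" "finite (insert Q \<C>)" using finH by auto
      show "{} \<inter> \<Union>(insert Q \<C>) = {}" "{} \<union> \<Union>(insert Q \<C>) = set_tree (Node l c r)" using U by auto
      show "card {} < s" using assms by simp
      show "\<forall>C\<in>insert Q \<C>. s \<le> card C \<and> card C < 2 * s" using sizes Q2s False by auto
      show "\<forall>x a. (x, a) \<in> near_ancestors k P (Node l c r) \<longrightarrow> a \<in> H \<union> set (take k P) \<or>
        (\<exists>C\<in>insert Q \<C>. x \<in> C \<and> a \<in> C) \<or> (x \<in> {} \<and> (a \<in> {} \<or> a \<in> set (take k P)))"
        using near by blast
    qed (use 1 2 in auto)
  qed
qed


text \<open>
  The residual set left at the end of the search has no stack above it, so it serves as one more part; this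
  accounts for the summand \<open>s\<close> in the bound on the number of parts.
\<close>

lemma no_long_cycle_structure:
  assumes "finite V" and "E \<subseteq> V \<times> V" and "s > 0"
    and short: "\<forall>xs. reversed_cycle E xs \<longrightarrow> length xs \<le> k"
  shows "\<exists>xs \<P> H. distinct xs \<and> set xs = V \<and> finite \<P> \<and> disjoint \<P> \<and> \<Union>\<P> = V \<and>
    card \<P> * s \<le> card V + s \<and> (\<forall>C\<in>\<P>. card C < 2 * s) \<and>
    finite H \<and> card H * s \<le> k * card V \<and>
    sorted_wrt (\<lambda>y x. (x, y) \<in> E \<longrightarrow> y \<in> H \<or> (\<exists>C\<in>\<P>. x \<in> C \<and> y \<in> C)) xs"
proof -
  obtain t where t: "dfs_forest E V t" "set_tree t = V" "distinct (inorder t)"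
    using dfs_forest_exists[of V V E] assms(1) by blast
  have near: "sorted_wrt (\<lambda>y x. (x, y) \<in> E \<longrightarrow> (x, y) \<in> near_ancestors k [] t) (inorder t)"
    using dfs_backward_arc_is_near[OF short t(1,3), of "[]"] by simp
  obtain H \<C> Q where sep: "finite H" "finite \<C>" "card H \<le> k * card \<C>"
    "disjoint \<C>" "Q \<inter> \<Union>\<C> = {}" "Q \<union> \<Union>\<C> = V"
    "card Q < s" "\<forall>C\<in>\<C>. s \<le> card C \<and> card C < 2 * s"
    "\<forall>x a. (x, a) \<in> near_ancestors k [] t \<longrightarrow> a \<in> H \<or> (\<exists>C\<in>\<C>. x \<in> C \<and> a \<in> C) \<or>
        (x \<in> Q \<and> (a \<in> Q \<or> a \<in> set (take k [])))"
    using near_ancestors_separator[OF t(3) assms(3), of k "[]"] unfolding t(2) by auto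
  have "card \<C> * s = (\<Sum>C\<in>\<C>. s)" by simp
  also have "\<dots> \<le> (\<Sum>C\<in>\<C>. card C)" using sep(8) by (intro sum_mono) auto
  also have "\<dots> = card (\<Union>\<C>)"
    using sep(2,4,6) assms(1)
    by (intro card_Union_disjoint[symmetric]) (auto simp: disjoint_def pairwise_def disjnt_def intro: finite_subset)
  also have "\<dots> \<le> card V" using sep(6) assms(1) by (intro card_mono) auto
  finally have card\<C>: "card \<C> * s \<le> card V" .
  have "card (insert Q \<C>) * s \<le> (card \<C> + 1) * s"
    using sep(2) by (intro mult_le_mono1) (simp add: card_insert_if)
  then have 1: "card (insert Q \<C>) * s \<le> card V + s" using card\<C> by simp
  have "card H * s \<le> k * (card \<C> * s)"
    using mult_le_mono1[OF sep(3), of s] by (simp add: mult.assoc)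
  also have "\<dots> \<le> k * card V" using card\<C> by simp
  finally have 2: "card H * s \<le> k * card V" .
  have 3: "sorted_wrt (\<lambda>y x. (x, y) \<in> E \<longrightarrow> y \<in> H \<or> (\<exists>C\<in>insert Q \<C>. x \<in> C \<and> y \<in> C)) (inorder t)"
    using sep(9) by (intro sorted_wrt_mono_rel[OF _ near]) fastforce
  have 4: "disjoint (insert Q \<C>)" using sep(4,5) by (auto simp: disjoint_def)
  show ?thesis
    using t 1 2 3 4 sep assms(3)
    by (intro exI[of _ "inorder t"] exI[of _ "insert Q \<C>"] exI[of _ H]) auto
qed

section \<open>Vertex lists and cycles of a digraph\<close>

lemma (in wf_digraph) descending_list_awalk:
  assumes "xs \<noteq> []" and "successively (\<lambda>a b. (b, a) \<in> arcs_ends G) xs" and "hd xs \<in> verts G"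
  shows "\<exists>w. awalk (last xs) w (hd xs) \<and> awalk_verts (last xs) w = rev xs"
  using assms
proof (induction xs rule: induct_list012)
  case (2 x)
  then show ?case by (intro exI[of _ "[]"]) (auto simp: awalk_Nil_iff)
next
  case (3 x y zs)
  from 3 obtain e where e: "e \<in> arcs G" "tail G e = y" "head G e = x"
    by (auto simp: arcs_ends_def arc_to_ends_def)
  then obtain w where w: "awalk (last (y # zs)) w y" "awalk_verts (last (y # zs)) w = rev (y # zs)"
    using 3 by auto
  have "awalk (last (y # zs)) (w @ [e]) x"
    using w e by (intro awalk_appendI[OF w(1)]) (auto simp: awalk_simps)
  moreover from this have "awalk_verts (last (y # zs)) (w @ [e]) = rev (x # y # zs)"
    using w e by (subst awalk_verts_append) auto
  ultimately show ?case by (intro exI[of _ "w @ [e]"]) (simp del: awalk_append_iff)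
qed simp

lemma (in wf_digraph) reversed_cycle_imp_cycle:
  assumes "reversed_cycle (arcs_ends G) xs"
  shows "\<exists>w. cycle w \<and> length w = length xs"
proof -
  from assms have xs: "xs \<noteq> []" "distinct xs" "successively (\<lambda>a b. (b, a) \<in> arcs_ends G) xs"
    and "(hd xs, last xs) \<in> arcs_ends G" by (auto simp: reversed_cycle_def)
  then obtain e where e: "e \<in> arcs G" "tail G e = hd xs" "head G e = last xs"
    by (auto simp: arcs_ends_def arc_to_ends_def)
  then have "hd xs \<in> verts G" by (metis tail_in_verts)
  then obtain w where w: "awalk (last xs) w (hd xs)" "awalk_verts (last xs) w = rev xs"
    using descending_list_awalk[OF xs(1,3)] by blast
  have "cycle (e # w)"
    \<comment> \<open>With the closing arc put first, the vertices after the start are exactly \<open>rev xs\<close>.\<close>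
    unfolding cycle_def using w e xs(2) by (intro exI[of _ "hd xs"]) (auto simp: awalk_simps)
  moreover have "length (e # w) = length xs"
    using arg_cong[OF w(2), of length] xs(1) by (simp add: length_awalk_verts)
  ultimately show ?thesis by blast
qed

section \<open>Lower bounds for arcs in a pseudorandom digraph\<close>

text \<open>
  Removing an element with the largest value does not increase the average, so repeated removal gives
  a subset of every size whose average is at most that of \<open>B\<close>.
\<close>

lemma subset_sum_le_average:
  fixes f :: "'a \<Rightarrow> real"
  assumes "finite B" and "a \<le> card B"
  shows "\<exists>B'\<subseteq>B. card B' = a \<and> real (card B) * sum f B' \<le> real a * sum f B"
  using assms(2)
proof (induction rule: inc_induct)
  case base
  then show ?case by (intro exI[of _ B]) auto
next
  case (step m)
  then obtain B' where B': "B' \<subseteq> B" "card B' = Suc m"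
    and le: "real (card B) * sum f B' \<le> real (Suc m) * sum f B" by blast
  have fin: "finite B'" using B' assms(1) finite_subset by blast
  have "Max (f ` B') \<in> f ` B'" using fin B'(2) by (intro Max_in) auto
  then obtain x where x: "x \<in> B'" "f x = Max (f ` B')" by auto
  have "sum f B' \<le> real (card B') * f x"
    unfolding x(2) by (rule sum_bounded_above) (use fin in simp)
  then have "real (Suc m) * sum f (B' - {x}) \<le> real m * sum f B'"
    using fin x B'(2) by (simp add: sum_diff1 algebra_simps)
  then have "real (card B) * (real (Suc m) * sum f (B' - {x})) \<le> real (card B) * (real m * sum f B')"
    by (intro mult_left_mono) auto
  also have "\<dots> = real m * (real (card B) * sum f B')" by simp
  also have "\<dots> \<le> real m * (real (Suc m) * sum f B)" using le by (intro mult_left_mono) auto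
  finally have "real (Suc m) * (real (card B) * sum f (B' - {x})) \<le> real (Suc m) * (real m * sum f B)"
    by (simp add: algebra_simps)
  then have "real (card B) * sum f (B' - {x}) \<le> real m * sum f B"
    by (rule mult_left_le_imp_le) simp
  then show ?case using x B' fin by (intro exI[of _ "B' - {x}"]) auto
qed

lemma card_vimage_eq_sum_fibres:
  assumes "finite S" and "finite B"
  shows "card {e \<in> S. g e \<in> B} = (\<Sum>b\<in>B. card {e \<in> S. g e = b})"
proof -
  have "{e \<in> S. g e \<in> B} = (\<Union>b\<in>B. {e \<in> S. g e = b})" by blast
  then show ?thesis using assms by simp (subst card_UN_disjoint, auto)
qed

text \<open>
  Pseudorandomness speaks of sets of equal size. In the larger of \<open>A\<close> and \<open>B\<close>, choose a subset of the size
  of the smaller one that receives at most its proportional share of the arcs. The lower bound for this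
  subset scales up to the whole set, and the error \<open>r * |A| * sqrt (p * n)\<close> grows only to \<open>r * n * sqrt (p * n)\<close>.
\<close>

lemma (in fin_digraph) pseudorandom_arcs_between_lower:
  assumes pr: "pseudorandom p r G" and r: "0 \<le> r" and A: "A \<subseteq> verts G" and B: "B \<subseteq> verts G"
    and disj: "A \<inter> B = {}"
  shows "real (num_arcs_between G A B) \<ge>
    p * real (card A) * real (card B) - r * sqrt (p * real (card (verts G))) * real (card (verts G))"
proof -
  define n where "n = real (card (verts G))"
  define d where "d = r * sqrt (p * n)"
  have dens: "real (card (arcs G)) = p * n\<^sup>2"
    using pr unfolding pseudorandom_def has_edge_density_def n_def by blast
  have n: "n \<ge> 0" unfolding n_def by simp
  have d: "d \<ge> 0"
  proof (cases "p * n \<ge> 0")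
    case True
    then show ?thesis unfolding d_def using r by simp
  next
    case False
    then have "n > 0" using n by (cases "n = 0") auto
    then have "p * n * n < 0" using mult_neg_pos[of "p * n" n] False by simp
    then show ?thesis using dens by (simp add: power2_eq_square mult.assoc)
  qed
  have fin: "finite A" "finite B" using A B finite_subset finite_verts by blast+
  have cardA: "real (card A) \<le> n" and cardB: "real (card B) \<le> n"
    unfolding n_def using A B by (simp_all add: card_mono)
  have eq: "real (num_arcs_between G A' B') \<ge> real (card A') * (p * real (card A') - d)"
    if "A' \<subseteq> A" "B' \<subseteq> B" "card A' = card B'" for A' B'
  proof -
    have "\<bar>real (num_arcs_between G A' B') - p * real (card A') * real (card B')\<bar> \<le> r * real (card A') * sqrt (p * n)"
    proof -
      have "A' \<subseteq> verts G" "B' \<subseteq> verts G" "A' \<inter> B' = {}" using that A B disj by auto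
      then show ?thesis using pr that(3) unfolding pseudorandom_def n_def by blast
    qed
    then show ?thesis unfolding d_def that(3) by (simp add: algebra_simps)
  qed
  \<comment> \<open>Scaling step: \<open>a\<close> is the smaller size, \<open>b\<close> the larger, \<open>e'\<close> counts the arcs at the chosen subset.\<close>
  have final: "p * real a * real b - d * n \<le> e"
    if "real b * e' \<le> real a * e" "e' \<ge> real a * (p * real a - d)" "real b \<le> n" "e \<ge> 0" for a b :: nat and e e' :: real
  proof (cases "a = 0")
    case True
    have "0 \<le> d * n" using d n by simp
    then show ?thesis using that(4) True by simp
  next
    case False
    have "real b * (real a * (p * real a - d)) \<le> real b * e'"
      using that(2) by (intro mult_left_mono) auto
    then have "real a * (real b * (p * real a - d)) \<le> real a * e"
      using that(1) by (simp add: algebra_simps)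
    then have "real b * (p * real a - d) \<le> e" using False by (simp add: mult_le_cancel_left_pos)
    moreover have "real b * d \<le> n * d" using that(3) d by (intro mult_right_mono)
    ultimately show ?thesis by (simp add: algebra_simps)
  qed
  have "p * real (card A) * real (card B) - d * n \<le> real (num_arcs_between G A B)"
  proof (cases "card A \<le> card B")
    case True
    define f where "f b = card {e \<in> {e \<in> arcs G. tail G e \<in> A}. head G e = b}" for b
    have sumf: "sum (\<lambda>b. real (f b)) B' = real (num_arcs_between G A B')" if "B' \<subseteq> B" for B'
    proof -
      have "finite B'" using that fin finite_subset by blast
      then show ?thesis
        using card_vimage_eq_sum_fibres[of "{e \<in> arcs G. tail G e \<in> A}" B' "head G"]
        unfolding f_def num_arcs_between_def by (simp add: conj_assoc)
    qed
    obtain B' where B': "B' \<subseteq> B" "card B' = card A"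
      "real (card B) * sum (\<lambda>b. real (f b)) B' \<le> real (card A) * sum (\<lambda>b. real (f b)) B"
      using subset_sum_le_average[OF fin(2) True] by blast
    show ?thesis
      using B' eq[of A B'] cardB
      by (intro final[where e' = "real (num_arcs_between G A B')"]) (auto simp: sumf)
  next
    case False
    define f where "f b = card {e \<in> {e \<in> arcs G. head G e \<in> B}. tail G e = b}" for b
    have sumf: "sum (\<lambda>b. real (f b)) A' = real (num_arcs_between G A' B)" if "A' \<subseteq> A" for A'
    proof -
      have "finite A'" using that fin finite_subset by blast
      then show ?thesis
        using card_vimage_eq_sum_fibres[of "{e \<in> arcs G. head G e \<in> B}" A' "tail G"]
        unfolding f_def num_arcs_between_def by (simp add: conj_ac)
    qed
    obtain A' where A': "A' \<subseteq> A" "card A' = card B"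
      "real (card A) * sum (\<lambda>b. real (f b)) A' \<le> real (card B) * sum (\<lambda>b. real (f b)) A"
      using subset_sum_le_average[OF fin(1), of "card B"] False by (meson nat_le_linear)
    have "p * real (card B) * real (card A) - d * n \<le> real (num_arcs_between G A B)"
      using A' eq[of A' B] cardA
      by (intro final[where e' = "real (num_arcs_between G A' B)"]) (auto simp: sumf)
    then show ?thesis by (simp add: mult_ac)
  qed
  then show ?thesis unfolding d_def n_def .
qed

text \<open>
  The pairs in \<open>S\<close> split into one product of disjoint cells for each element of \<open>Rel\<close>, so the error
  term is paid \<open>card Rel\<close> times. It is harmless when the number of colours is bounded.
\<close>

lemma (in fin_digraph) pseudorandom_arcs_between_cells:
  fixes \<kappa> :: "'a \<Rightarrow> 'c"
  assumes pr: "pseudorandom p r G" and r: "0 \<le> r" and W: "W \<subseteq> verts G"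
    and "finite Rel" and "irrefl Rel"
  defines "S \<equiv> {(x, y). x \<in> W \<and> y \<in> W \<and> (\<kappa> x, \<kappa> y) \<in> Rel}"
  shows "real (card {e \<in> arcs G. (tail G e, head G e) \<in> S}) \<ge>
    p * real (card S) - real (card Rel) * (r * sqrt (p * real (card (verts G))) * real (card (verts G)))"
proof -
  define cell where "cell \<alpha> = {x \<in> W. \<kappa> x = \<alpha>}" for \<alpha>
  define err where "err = r * sqrt (p * real (card (verts G))) * real (card (verts G))"
  have finW: "finite W" using W finite_subset finite_verts by blast
  have fin: "finite (cell \<alpha>)" for \<alpha> unfolding cell_def using finW by simp
  have "S = (\<Union>(\<alpha>, \<beta>)\<in>Rel. cell \<alpha> \<times> cell \<beta>)" unfolding S_def cell_def by auto
  then have "card S = (\<Sum>(\<alpha>, \<beta>)\<in>Rel. card (cell \<alpha> \<times> cell \<beta>))"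
    using assms(4) fin by (simp add: case_prod_beta) (subst card_UN_disjoint, auto simp: cell_def)
  then have cardS: "real (card S) = (\<Sum>(\<alpha>, \<beta>)\<in>Rel. real (card (cell \<alpha>)) * real (card (cell \<beta>)))"
    by (simp add: case_prod_beta card_cartesian_product)
  have "{e \<in> arcs G. (tail G e, head G e) \<in> S} =
      (\<Union>(\<alpha>, \<beta>)\<in>Rel. {e \<in> arcs G. tail G e \<in> cell \<alpha> \<and> head G e \<in> cell \<beta>})"
    unfolding S_def cell_def by auto
  then have cardarcs: "card {e \<in> arcs G. (tail G e, head G e) \<in> S} =
      (\<Sum>(\<alpha>, \<beta>)\<in>Rel. num_arcs_between G (cell \<alpha>) (cell \<beta>))"
    unfolding num_arcs_between_def
    using assms(4) by (simp add: case_prod_beta) (subst card_UN_disjoint, auto simp: cell_def)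
  have "p * real (card S) - real (card Rel) * err =
      (\<Sum>(\<alpha>, \<beta>)\<in>Rel. p * real (card (cell \<alpha>)) * real (card (cell \<beta>)) - err)"
    unfolding cardS by (simp add: sum_subtractf sum_distrib_left case_prod_beta mult.assoc)
  also have "\<dots> \<le> (\<Sum>(\<alpha>, \<beta>)\<in>Rel. real (num_arcs_between G (cell \<alpha>) (cell \<beta>)))"
  proof (intro sum_mono, clarify)
    fix \<alpha> \<beta> assume "(\<alpha>, \<beta>) \<in> Rel"
    then have "\<alpha> \<noteq> \<beta>" using assms(5) by (auto simp: irrefl_def)
    then show "p * real (card (cell \<alpha>)) * real (card (cell \<beta>)) - err \<le> real (num_arcs_between G (cell \<alpha>) (cell \<beta>))"
      unfolding err_def using W
      by (intro pseudorandom_arcs_between_lower[OF pr r]) (auto simp: cell_def)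
  qed
  also have "\<dots> = real (card {e \<in> arcs G. (tail G e, head G e) \<in> S})"
    unfolding cardarcs by (simp add: case_prod_beta)
  finally show ?thesis unfolding err_def .
qed


section \<open>Counting missed arcs\<close>

text \<open>
  Inequality of \<open>c\<close> is symmetric, so of the ordered pairs that avoid \<open>H\<close> and differ in both \<open>i\<close> and \<open>c\<close>, one
  half lies in \<open>S\<close> and the other half in its converse.
\<close>

lemma card_ordered_separated_pairs:
  fixes i :: "'a \<Rightarrow> nat"
  assumes V: "finite V" and H: "finite H"
    and a: "\<And>x. x \<in> V \<Longrightarrow> card {y \<in> V. i y = i x} \<le> a"
    and b: "\<And>x. x \<in> V \<Longrightarrow> card {y \<in> V. c y = c x} \<le> b"
  defines "S \<equiv> {(x, y). x \<in> V - H \<and> y \<in> V - H \<and> i y < i x \<and> c x \<noteq> c y}"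
  shows "(card V)\<^sup>2 \<le> 2 * card S + card V * (a + b + 2 * card H)"
proof -
  define I where "I = (SIGMA x:V. {y \<in> V. i y = i x})"
  define J where "J = (SIGMA x:V. {y \<in> V. c y = c x})"
  have cover: "V \<times> V \<subseteq> S \<union> S\<inverse> \<union> I \<union> J \<union> V \<times> H \<union> H \<times> V"
  proof (intro subrelI)
    fix x y assume "(x, y) \<in> V \<times> V"
    then show "(x, y) \<in> S \<union> S\<inverse> \<union> I \<union> J \<union> V \<times> H \<union> H \<times> V"
      unfolding S_def I_def J_def by (cases "i x" "i y" rule: linorder_cases) auto
  qed
  have "S \<subseteq> V \<times> V" unfolding S_def by auto
  then have finS: "finite S" using V finite_subset by blast
  have finIJ: "finite I" "finite J" unfolding I_def J_def using V by auto
  have "card I \<le> card V * a"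
    unfolding I_def using V a sum_bounded_above[of V "\<lambda>x. card {y \<in> V. i y = i x}" a] by simp
  moreover have "card J \<le> card V * b"
    unfolding J_def using V b sum_bounded_above[of V "\<lambda>x. card {y \<in> V. c y = c x}" b] by simp
  moreover have "card (V \<times> V) \<le> card S + card (S\<inverse>) + card I + card J + card (V \<times> H) + card (H \<times> V)"
  proof -
    have "card (V \<times> V) \<le> card (S \<union> S\<inverse> \<union> I \<union> J \<union> V \<times> H \<union> H \<times> V)"
      using cover finS finIJ V H by (intro card_mono) auto
    also have "\<dots> \<le> card S + card (S\<inverse>) + card I + card J + card (V \<times> H) + card (H \<times> V)"
      by (intro order_trans[OF card_Un_le] add_mono order_refl)
    finally show ?thesis .
  qed
  ultimately show ?thesis by (simp add: card_cartesian_product power2_eq_square algebra_simps)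
qed

text \<open>
  Each of three losses is of order \<open>n\<^sup>2 / D\<close>: pairs in the same block of \<open>s\<close> consecutive places, pairs in the
  same part, and pairs that meet \<open>H\<close>. Together they cost \<open>8 * n\<^sup>2 / D\<close> ordered pairs, that is, \<open>4 * n\<^sup>2 / D\<close> backward
  ones. Blocks are needed because parts interleave in the order: the colour of a vertex is
  its block together with its part, which makes the relation between two vertices in question a
  relation between their colours. There are at most \<open>D\<^sup>2\<close> colours and so at most \<open>D ^ 4\<close> pairs of colours; the
  factor \<open>1 / D ^ 5\<close> in the error hypothesis turns their total error into the fifth \<open>1 / D\<close>.
\<close>

lemma (in fin_digraph) many_arcs_missed_without_long_cycle:
  fixes D :: nat
  assumes pr: "pseudorandom p r G" and r: "0 \<le> r" and p: "0 \<le> p" and D: "D > 0"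
    and n: "card (verts G) \<ge> D"
    and err: "r * sqrt (p * real (card (verts G))) \<le> p * real (card (verts G)) / real D ^ 5"
    and E: "E \<subseteq> verts G \<times> verts G"
    and short: "\<forall>xs. reversed_cycle E xs \<longrightarrow> length xs \<le> card (verts G) div D\<^sup>2"
  shows "real (card {e \<in> arcs G. (tail G e, head G e) \<notin> E}) \<ge>
    (1 / 2 - 5 / real D) * (p * (real (card (verts G)))\<^sup>2)"
proof -
  define n where "n = card (verts G)"
  define s where "s = n div D + 1"
  define k where "k = n div D\<^sup>2"
  have s: "s > 0" unfolding s_def by simp
  \<comment> \<open>The summand \<open>1\<close> in \<open>s\<close> makes \<open>D\<close> blocks of length \<open>s\<close> cover all places of the order.\<close>
  have nsD: "n < s * D"
    unfolding s_def using D by (metis add.commute dividend_less_div_times plus_1_eq_Suc mult_Suc)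
  have sD: "s * D \<le> 2 * n"
  proof -
    have "s * D = n div D * D + D" unfolding s_def by simp
    also have "\<dots> \<le> n + n" using n unfolding n_def by (intro add_mono) auto
    finally show ?thesis by simp
  qed
  have n0: "n > 0" using n D unfolding n_def by simp
  obtain xs \<P> H where xs: "distinct xs" "set xs = verts G"
    and \<P>: "finite \<P>" "disjoint \<P>" "\<Union>\<P> = verts G" "card \<P> * s \<le> n + s" "\<forall>C\<in>\<P>. card C < 2 * s"
    and H: "finite H" "card H * s \<le> k * n"
    and ord: "sorted_wrt (\<lambda>y x. (x, y) \<in> E \<longrightarrow> y \<in> H \<or> (\<exists>C\<in>\<P>. x \<in> C \<and> y \<in> C)) xs"
    using no_long_cycle_structure[OF finite_verts E s short, folded n_def, folded k_def]
    by (elim exE conjE) (rule that, assumption+)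
  have len: "length xs = n" using xs unfolding n_def by (metis distinct_card)
  define pos where "pos = inv_into {..<n} ((!) xs)"
  have pos: "pos x < n \<and> xs ! pos x = x" if "x \<in> verts G" for x
  proof -
    have "x \<in> (!) xs ` {..<n}" using that xs(2) len by (metis image_eqI in_set_conv_nth lessThan_iff)
    from inv_into_into[OF this] f_inv_into_f[OF this] show ?thesis unfolding pos_def by simp
  qed
  define comp where "comp x = (THE C. C \<in> \<P> \<and> x \<in> C)" for x
  have comp_eq: "comp x = C" if "C \<in> \<P>" "x \<in> C" for x C
    unfolding comp_def using that \<P>(2) by (intro the_equality) (auto simp: disjoint_def)
  have comp: "comp x \<in> \<P>" "x \<in> comp x" if "x \<in> verts G" for x
    using that \<P>(3) comp_eq by blast+
  define K where "K = {..<D} \<times> \<P>"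
  define Rel where "Rel = {((i, C), (j, C')). (i, C) \<in> K \<and> (j, C') \<in> K \<and> j < i \<and> C \<noteq> C'}"
  define \<kappa> where "\<kappa> x = (pos x div s, comp x)" for x
  define S where "S = {(x, y). x \<in> verts G - H \<and> y \<in> verts G - H \<and> (\<kappa> x, \<kappa> y) \<in> Rel}"
  have \<kappa>K: "\<kappa> x \<in> K" if "x \<in> verts G" for x
    unfolding K_def \<kappa>_def using that comp pos[OF that] nsD s
    by (auto simp: less_mult_imp_div_less mult.commute)
  have S_eq: "S = {(x, y). x \<in> verts G - H \<and> y \<in> verts G - H \<and> pos y div s < pos x div s \<and> comp x \<noteq> comp y}"
    unfolding S_def Rel_def using \<kappa>K by (auto simp: \<kappa>_def)
  have S_missed: "(x, y) \<notin> E" if "(x, y) \<in> S" for x y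
  proof
    assume "(x, y) \<in> E"
    have x: "x \<in> verts G" and y: "y \<in> verts G" "y \<notin> H" and less: "pos y div s < pos x div s"
      and diff: "comp x \<noteq> comp y" using that unfolding S_eq by auto
    have "pos y < pos x" using less by (meson div_le_mono leD leI)
    then have "(xs ! pos x, xs ! pos y) \<in> E \<longrightarrow> xs ! pos y \<in> H \<or> (\<exists>C\<in>\<P>. xs ! pos x \<in> C \<and> xs ! pos y \<in> C)"
      using pos[OF x] len by (intro sorted_wrt_nth_less[OF ord]) auto
    then obtain C where "C \<in> \<P>" "x \<in> C" "y \<in> C"
      using pos[OF x] pos[OF y(1)] \<open>(x, y) \<in> E\<close> y(2) by auto
    then show False using comp_eq diff by metis
  qed
  have "(card (verts G))\<^sup>2 \<le> 2 * card S + card (verts G) * (s + 2 * s + 2 * card H)"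
    unfolding S_eq
  proof (rule card_ordered_separated_pairs)
    fix x assume x: "x \<in> verts G"
    have "pos ` {y \<in> verts G. pos y div s = pos x div s} \<subseteq> {pos x div s * s ..< pos x div s * s + s}"
    proof (intro image_subsetI)
      fix y assume "y \<in> {y \<in> verts G. pos y div s = pos x div s}"
      then have "pos x div s * s + pos y mod s = pos y" by (metis (mono_tags) div_mult_mod_eq mem_Collect_eq)
      moreover have "pos y mod s < s" using s by simp
      ultimately show "pos y \<in> {pos x div s * s ..< pos x div s * s + s}"
        unfolding atLeastLessThan_iff by linarith
    qed
    moreover have "inj_on pos {y \<in> verts G. pos y div s = pos x div s}"
      by (rule inj_on_inverseI[where g = "(!) xs"]) (simp add: pos)
    ultimately have "card {y \<in> verts G. pos y div s = pos x div s} \<le>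
        card {pos x div s * s ..< pos x div s * s + s}"
      by (intro card_inj_on_le[of pos]) auto
    then show "card {y \<in> verts G. pos y div s = pos x div s} \<le> s" by simp
    have "{y \<in> verts G. comp y = comp x} \<subseteq> comp x" using comp by auto
    moreover have "comp x \<subseteq> verts G" using comp(1)[OF x] \<P>(3) by blast
    ultimately have "card {y \<in> verts G. comp y = comp x} \<le> card (comp x)"
      by (intro card_mono) (auto intro: finite_subset[OF _ finite_verts])
    then show "card {y \<in> verts G. comp y = comp x} \<le> 2 * s"
      using \<P>(5) comp(1)[OF x] by fastforce
  qed (use H in auto)
  then have "n ^ 2 \<le> 2 * card S + n * (3 * s + 2 * card H)" unfolding n_def by (simp add: algebra_simps)
  then have "D * n ^ 2 \<le> D * (2 * card S + n * (3 * s + 2 * card H))" by (rule mult_le_mono2)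
  also have "\<dots> = 2 * D * card S + n * (3 * (s * D) + 2 * (card H * D))" by (simp add: algebra_simps)
  also have "\<dots> \<le> 2 * D * card S + n * (3 * (2 * n) + 2 * n)"
  proof -
    have "card H * n \<le> card H * (s * D)" using nsD by (intro mult_le_mono2) simp
    also have "\<dots> \<le> k * n * D" using H(2) by (simp add: mult.assoc[symmetric])
    \<comment> \<open>There are at most \<open>D\<close> cuts, and each of them deletes at most \<open>k\<close> vertices.\<close>
    finally have "card H \<le> k * D" using n0 by (simp add: mult_ac)
    then have "card H * D \<le> k * D\<^sup>2" by (simp add: power2_eq_square mult_ac)
    also have "\<dots> \<le> n" unfolding k_def by simp
    finally show ?thesis using sD by (intro add_mono mult_le_mono2) auto
  qed
  also have "\<dots> = 2 * D * card S + 8 * n ^ 2" by (simp add: power2_eq_square)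
  finally have "real (D * n ^ 2) \<le> real (2 * D * card S + 8 * n ^ 2)" by (rule of_nat_mono)
  then have cardS: "real (card S) \<ge> (1 / 2 - 4 / real D) * (real n)\<^sup>2"
    using D by (simp add: field_simps)
  have finK: "finite K" unfolding K_def using \<P>(1) by simp
  have "Rel \<subseteq> K \<times> K" unfolding Rel_def by auto
  then have finRel: "finite Rel" and "card Rel \<le> card (K \<times> K)"
    using finK by (meson finite_SigmaI finite_subset, meson finite_SigmaI card_mono)
  moreover have "card \<P> \<le> D"
  proof -
    have "card \<P> * s < (D + 1) * s" using \<P>(4) nsD by (simp add: algebra_simps)
    then show ?thesis by (simp only: mult_less_cancel2) simp
  qed
  then have "card K \<le> D\<^sup>2" unfolding K_def by (simp add: card_cartesian_product power2_eq_square)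
  then have "card (K \<times> K) \<le> D\<^sup>2 * D\<^sup>2" unfolding card_cartesian_product by (intro mult_le_mono)
  ultimately have "card Rel \<le> D ^ 4" by (simp add: power_add[symmetric])
  then have cardRel: "real (card Rel) \<le> real D ^ 4" by (metis of_nat_le_iff of_nat_power)
  have "irrefl Rel" unfolding Rel_def irrefl_def by auto
  then have "p * real (card S) - real (card Rel) * (r * sqrt (p * real n) * real n) \<le>
      real (card {e \<in> arcs G. (tail G e, head G e) \<in> S})"
    unfolding S_def n_def using finRel
    by (intro pseudorandom_arcs_between_cells[OF pr r]) auto
  also have "\<dots> \<le> real (card {e \<in> arcs G. (tail G e, head G e) \<notin> E})"
    using S_missed by (intro of_nat_mono card_mono) auto
  moreover have "real (card Rel) * (r * sqrt (p * real n) * real n) \<le> p * (real n)\<^sup>2 / real D"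
  proof -
    have "real (card Rel) * (r * sqrt (p * real n) * real n) \<le> real D ^ 4 * (p * real n / real D ^ 5 * real n)"
      using cardRel err r p unfolding n_def by (intro mult_mono) auto
    also have "\<dots> = p * (real n)\<^sup>2 / real D" using D by (simp add: field_simps power2_eq_square eval_nat_numeral)
    finally show ?thesis .
  qed
  moreover have "p * ((1 / 2 - 4 / real D) * (real n)\<^sup>2) \<le> p * real (card S)"
    using cardS p by (intro mult_left_mono)
  moreover have "(1 / 2 - 5 / real D) * (p * (real n)\<^sup>2) =
      p * ((1 / 2 - 4 / real D) * (real n)\<^sup>2) - p * (real n)\<^sup>2 / real D"
    by (simp add: algebra_simps)
  ultimately show ?thesis unfolding n_def by linarith
qed

theorem corollary5:
  shows "\<forall>\<gamma>::real. \<gamma> > 0 \<longrightarrow>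
    (\<exists>(c\<^sub>1::real) (\<mu>::real) (C::real) (n\<^sub>0::nat). c\<^sub>1 > 0 \<and> \<mu> > 0 \<and> C > 0 \<and>
      (\<forall>(n::nat) (p::real) (r::real) (G::('a, 'b) pre_digraph) (G'::('a, 'b) pre_digraph).
         n \<ge> n\<^sub>0 \<and> p \<ge> C / real n \<and> 0 \<le> r \<and> r \<le> \<mu> * sqrt (real n * p) \<and>
         digraph G \<and> card (verts G) = n \<and> pseudorandom p r G \<and>
         subgraph G' G \<and> real (card (arcs G')) \<ge> (1 / 2 + \<gamma>) * real (card (arcs G)) \<longrightarrow>
         (\<exists>w. pre_digraph.cycle G' w \<and> real (length w) \<ge> c\<^sub>1 * real n)))"
proof (intro allI impI)
  fix \<gamma> :: real assume \<gamma>: "\<gamma> > 0"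
  obtain D :: nat where D: "5 / \<gamma> < real D" using reals_Archimedean2 by blast
  have D0: "D > 0" using D \<gamma> by (intro gr0I) (auto simp: field_simps)
  have D\<gamma>: "5 / real D < \<gamma>" using D D0 \<gamma> by (simp add: field_simps)
  show "\<exists>(c\<^sub>1::real) (\<mu>::real) (C::real) (n\<^sub>0::nat). c\<^sub>1 > 0 \<and> \<mu> > 0 \<and> C > 0 \<and>
      (\<forall>(n::nat) (p::real) (r::real) (G::('a, 'b) pre_digraph) (G'::('a, 'b) pre_digraph).
         n \<ge> n\<^sub>0 \<and> p \<ge> C / real n \<and> 0 \<le> r \<and> r \<le> \<mu> * sqrt (real n * p) \<and>
         digraph G \<and> card (verts G) = n \<and> pseudorandom p r G \<and>
         subgraph G' G \<and> real (card (arcs G')) \<ge> (1 / 2 + \<gamma>) * real (card (arcs G)) \<longrightarrow>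
         (\<exists>w. pre_digraph.cycle G' w \<and> real (length w) \<ge> c\<^sub>1 * real n))"
  proof (rule exI[of _ "1 / real D ^ 2"], rule exI[of _ "1 / real D ^ 5"], rule exI[of _ 1],
      rule exI[of _ D], intro conjI allI impI; (elim conjE)?)
    fix n :: nat and p r :: real and G G' :: "('a, 'b) pre_digraph"
    assume n: "n \<ge> D" and p: "p \<ge> 1 / real n" and r: "0 \<le> r" "r \<le> 1 / real D ^ 5 * sqrt (real n * p)"
      and G: "digraph G" "card (verts G) = n" and pr: "pseudorandom p r G"
      and sub: "subgraph G' G" and many: "real (card (arcs G')) \<ge> (1 / 2 + \<gamma>) * real (card (arcs G))"
    interpret G: digraph G by fact
    interpret G': wf_digraph G' using sub unfolding subgraph_def by blast
    have sub': "verts G' \<subseteq> verts G" "arcs G' \<subseteq> arcs G" "tail G' = tail G" "head G' = head G"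
      using sub unfolding subgraph_def compatible_def by auto
    have n0: "n > 0" using n D0 by simp
    then have p0: "p > 0" using p by (meson divide_pos_pos less_le_trans of_nat_0_less_iff zero_less_one)
    have err: "r * sqrt (p * real n) \<le> p * real n / real D ^ 5"
    proof -
      have "r * sqrt (p * real n) \<le> 1 / real D ^ 5 * sqrt (real n * p) * sqrt (p * real n)"
        using r(2) p0 by (intro mult_right_mono) auto
      also have "\<dots> = p * real n / real D ^ 5" using p0 by (simp add: mult.commute)
      finally show ?thesis .
    qed
    show "\<exists>w. G'.cycle w \<and> real (length w) \<ge> 1 / real D ^ 2 * real n"
    proof (rule ccontr)
      assume none: "\<not> ?thesis"
      have short: "length xs \<le> n div D\<^sup>2" if cyc: "reversed_cycle (arcs_ends G') xs" for xs
      proof -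
        obtain w where "G'.cycle w" "length w = length xs" using G'.reversed_cycle_imp_cycle[OF cyc] by blast
        then have "real (length xs) < 1 / real D ^ 2 * real n" using none by force
        then have "real (length xs * D\<^sup>2) < real n" using D0 by (simp add: field_simps)
        then have "length xs * D\<^sup>2 \<le> n" by (simp only: of_nat_less_iff)
        then show ?thesis using D0 by (simp add: less_eq_div_iff_mult_less_eq)
      qed
      have "arcs_ends G' \<subseteq> verts G \<times> verts G"
        using sub' by (auto simp: arcs_ends_def arc_to_ends_def)
      then have "(1 / 2 - 5 / real D) * (p * (real n)\<^sup>2) \<le>
          real (card {e \<in> arcs G. (tail G e, head G e) \<notin> arcs_ends G'})"
        using G.many_arcs_missed_without_long_cycle[OF pr r(1) _ D0, of "arcs_ends G'"] p0 n err short
        unfolding G(2) by simp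
      also have "\<dots> \<le> real (card (arcs G - arcs G'))"
        using sub' by (intro of_nat_mono card_mono) (auto simp: arcs_ends_def arc_to_ends_def)
      also have "\<dots> = real (card (arcs G)) - real (card (arcs G'))"
        using sub'(2) by (simp add: card_Diff_subset finite_subset card_mono)
      also have "\<dots> \<le> (1 / 2 - \<gamma>) * real (card (arcs G))" using many by (simp add: algebra_simps)
      also have "real (card (arcs G)) = p * (real n)\<^sup>2"
        using pr G(2) unfolding pseudorandom_def has_edge_density_def by simp
      finally have "1 / 2 - 5 / real D \<le> 1 / 2 - \<gamma>" using p0 n0 by (simp add: mult_le_cancel_right)
      then show False using D\<gamma> by simp
    qed
  qed (use D0 in auto)
qed

end
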